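(* Let $n\ge1$, let $I_1,\ldots,I_n$ be independent random variables with values in $\{0,1\}$, $p_i=\Pr(I_i=1)=1-\Pr(I_i=0)\in[0,1]$, and let $S_n=I_1+\cdots+I_n$. Put $\lambda_j=\sum_{i=1}^n p_i^j$ for $j=1,2,\ldots$ and $\lambda=\lambda_1$, and assume $\lambda>0$. Let $\mu_m=\mathbb E\big[(S_n)_m\big]$ be the $m$-th factorial moment of $S_n$. Then for all integers $m\ge1$, $$\mu_m\ge\lambda^m-\frac{(m)_2}{2}\lambda_2\lambda^{m-2}+\frac{(m)_3}{3}\lambda_3\lambda^{m-3}+\frac{(m)_4}{8}\lambda_2^2\lambda^{m-4}-\frac{(m)_4(m)_2}{48}\lambda_4\lambda^{m-4}.$$
   Context: For integers $k,m\ge0$, $(k)_m=k(k-1)\cdots(k-m+1)$, with $(k)_0=1$; in particular $(m)_2=m(m-1)$, $(m)_3=m(m-1)(m-2)$, $(m)_4=m(m-1)(m-2)(m-3)$, and terms with a vanishing factor $(m)_j$ (i.e. $m<j$) are zero. *)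

theory Defs
  imports "HOL-Probability.Probability"
begin

definition ffact :: "nat \<Rightarrow> nat \<Rightarrow> real" where
  "ffact k m = (\<Prod>j<m. (real k - real j))"

end

theory Submission
  imports Defs
begin

text \<open>
  The factorial moment \<open>\<mu> m\<close> equals \<open>m!\<close> times the elementary symmetric polynomial
  \<open>e\<^sub>m(p)\<close>, so the claim is an inequality between symmetric polynomials that is homogeneous of
  degree \<open>m\<close>. After division by \<open>\<lambda>\<close> one may take \<open>\<lambda> = 1\<close>. Then \<open>p\<close> is a probability
  distribution, and \<open>\<mu> m\<close> is the probability that \<open>m\<close> independent samples from it are pairwise
  distinct.

  Let \<open>W j k\<close> (formally \<open>wsum\<close>) be the sum of \<open>p\<^sub>i\<^sup>j \<mu>\<^sub>k(p without p\<^sub>i)\<close> over \<open>i\<close>. Newton's identities, stopped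
  early, take the form
  \<open>\<mu> (k + 1) = W 1 k\<close> (\<open>fesym_Suc_eq_wsum\<close>) and
  \<open>W j k = \<lambda>\<^sub>j \<mu> k - k W (j + 1) (k - 1)\<close> (\<open>wsum_rec\<close>), with the remainder controlled by
  \<open>0 \<le> W j k \<le> \<lambda>\<^sub>j \<mu> k\<close>. In particular \<open>\<mu> (k + 1) - \<mu> k = - k W 2 (k - 1)\<close>. Summing these
  differences gives successively sharper bounds, alternately from below and from above:
  \<^item> \<open>W 2 \<le> \<lambda>\<^sub>2\<close> gives a lower bound of first order (\<open>f_ge_order_1\<close>);
  \<^item> expanding \<open>W 2\<close> once and inserting the first-order bound gives an upper bound of second
    order (\<open>f_le_order_2\<close>);
  \<^item> expanding \<open>W 2\<close> twice and inserting both gives the lower bound that is wanted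
    (\<open>f_ge_order_3\<close>).

  In the last step the new error terms carry \<open>\<lambda>\<^sub>2 \<lambda>\<^sub>3\<close>, \<open>\<lambda>\<^sub>2\<^sup>3\<close> and \<open>\<lambda>\<^sub>4\<close>. The first two are at most
  \<open>\<lambda>\<^sub>4\<close> (\<open>l_2_mult_l_3_le_l_4\<close>, \<open>l_2_cube_le_l_4\<close>), and with \<open>x = m - 2\<close> the increment from
  \<open>m - 1\<close> to \<open>m\<close> of the coefficient \<open>(m)\<^sub>4 (m)\<^sub>2 / 48\<close> is exactly
  \<open>(m - 1) (5 (x)\<^sub>3 / 6 + (x)\<^sub>4 / 8 + (x)\<^sub>2)\<close>, the total that these errors add up to. This is where
  the coefficient of \<open>\<lambda>\<^sub>4\<close> comes from.
\<close>

section \<open>Elementary symmetric polynomials and truncated Newton identities\<close>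

text \<open>
  Elementary symmetric polynomials scaled by \<open>m!\<close>, that is, sums over ordered choices of \<open>m\<close>
  distinct indices. With this scaling they are factorial moments, and the recursions below have no
  denominators.
\<close>

definition fesym :: "('i \<Rightarrow> real) \<Rightarrow> 'i set \<Rightarrow> nat \<Rightarrow> real" where
  "fesym p A m = fact m * (\<Sum>B | B \<subseteq> A \<and> card B = m. \<Prod>i\<in>B. p i)"

text \<open>
  For a probability distribution \<open>p\<close> this is the probability that, among \<open>j + k\<close> independent
  samples, the first \<open>j\<close> (with \<open>j \<ge> 1\<close>) agree while the last \<open>k\<close> are pairwise distinct and avoid
  their common value.
\<close>

definition wsum :: "('i \<Rightarrow> real) \<Rightarrow> 'i set \<Rightarrow> nat \<Rightarrow> nat \<Rightarrow> real" where
  "wsum p A j k = (\<Sum>i\<in>A. p i ^ j * fesym p (A - {i}) k)"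

lemma fesym_0: "finite A \<Longrightarrow> fesym p A 0 = 1"
proof -
  assume "finite A"
  then have "{B. B \<subseteq> A \<and> card B = 0} = {{}}"
    by (auto simp: card_eq_0_iff dest: finite_subset)
  then show ?thesis by (simp add: fesym_def)
qed

lemma fesym_empty_Suc: "fesym p {} (Suc m) = 0"
proof -
  have "{B::'a set. B \<subseteq> {} \<and> card B = Suc m} = {}" by auto
  then show ?thesis by (simp add: fesym_def)
qed

lemma fesym_nonneg:
  assumes "\<And>i. i \<in> A \<Longrightarrow> p i \<ge> 0"
  shows "fesym p A m \<ge> 0"
  unfolding fesym_def using assms
  by (intro mult_nonneg_nonneg sum_nonneg prod_nonneg) auto

text \<open>
  A set of \<open>m + 1\<close> indices either avoids \<open>a\<close> or is \<open>a\<close> together with \<open>m\<close> other indices. The factor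
  \<open>m + 1\<close> counts the positions that \<open>a\<close> can take in an ordered choice.
\<close>

lemma fesym_insert:
  assumes "finite A" "a \<notin> A"
  shows "fesym p (insert a A) (Suc m) = fesym p A (Suc m) + real (Suc m) * p a * fesym p A m"
proof -
  let ?C = "{B. B \<subseteq> A \<and> card B = Suc m}" and ?D = "{B. B \<subseteq> A \<and> card B = m}"
  have fin: "finite ?C" "finite ?D" using assms(1) by auto
  have split: "{B. B \<subseteq> insert a A \<and> card B = Suc m} = ?C \<union> insert a ` ?D"
  proof (intro equalityI subsetI)
    fix B assume B: "B \<in> {B. B \<subseteq> insert a A \<and> card B = Suc m}"
    show "B \<in> ?C \<union> insert a ` ?D"
    proof (cases "a \<in> B")
      case True
      then have "B = insert a (B - {a})" "card (B - {a}) = m" "B - {a} \<subseteq> A"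
        using B by auto
      then show ?thesis by blast
    qed (use B in auto)
  next
    fix B assume "B \<in> ?C \<union> insert a ` ?D"
    then show "B \<in> {B. B \<subseteq> insert a A \<and> card B = Suc m}"
      using assms by (auto intro!: card_insert_disjoint dest: finite_subset)
  qed
  have inj: "inj_on (insert a) ?D"
    using assms(2) by (intro inj_onI) (metis (mono_tags, lifting) insert_ident mem_Collect_eq subsetD)
  have "(\<Sum>B | B \<subseteq> insert a A \<and> card B = Suc m. \<Prod>i\<in>B. p i)
      = (\<Sum>B\<in>?C. \<Prod>i\<in>B. p i) + (\<Sum>B\<in>insert a ` ?D. \<Prod>i\<in>B. p i)"
    unfolding split using fin assms(2) by (intro sum.union_disjoint) auto
  also have "(\<Sum>B\<in>insert a ` ?D. \<Prod>i\<in>B. p i) = (\<Sum>B\<in>?D. \<Prod>i\<in>insert a B. p i)"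
    using inj by (simp add: sum.reindex)
  also have "\<dots> = (\<Sum>B\<in>?D. p a * (\<Prod>i\<in>B. p i))"
    using assms by (intro sum.cong refl prod.insert) (auto dest: finite_subset)
  finally show ?thesis
    by (simp add: fesym_def sum_distrib_left algebra_simps)
qed

text \<open>
  Single out the first entry \<open>i\<close> of an ordered choice of \<open>m + 1\<close> distinct indices.
\<close>

lemma fesym_Suc_eq_wsum:
  assumes "finite A"
  shows "fesym p A (Suc m) = wsum p A 1 m"
  using assms
proof (induction A arbitrary: m rule: finite_induct)
  case empty
  then show ?case by (simp add: fesym_empty_Suc wsum_def)
next
  case (insert a A)
  have del: "insert a A - {i} = insert a (A - {i})" if "i \<in> A" for i
    using insert.hyps that by auto
  have A: "insert a A - {a} = A" using insert.hyps by auto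
  show ?case
  proof (cases m)
    case 0
    then show ?thesis
      using insert by (simp add: fesym_insert wsum_def fesym_0)
  next
    case (Suc k)
    have "wsum p (insert a A) 1 m = p a * fesym p A m + (\<Sum>i\<in>A. p i * fesym p (insert a (A - {i})) m)"
      using insert.hyps by (simp add: wsum_def A del)
    also have "(\<Sum>i\<in>A. p i * fesym p (insert a (A - {i})) m)
       = (\<Sum>i\<in>A. p i * fesym p (A - {i}) m) + real m * p a * (\<Sum>i\<in>A. p i * fesym p (A - {i}) k)"
      using insert.hyps unfolding Suc
      by (simp add: fesym_insert sum.distrib sum_distrib_left algebra_simps)
    also have "(\<Sum>i\<in>A. p i * fesym p (A - {i}) m) = fesym p A (Suc m)"
      by (simp add: insert.IH wsum_def)
    also have "(\<Sum>i\<in>A. p i * fesym p (A - {i}) k) = fesym p A m"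
      by (simp add: insert.IH wsum_def Suc)
    finally show ?thesis
      using insert.hyps by (simp add: fesym_insert algebra_simps)
  qed
qed

text \<open>
  In terms of samples, for \<open>j \<ge> 1\<close>: removing the condition that the \<open>k\<close> distinct samples avoid the common value of the first \<open>j\<close>
  gives the first term. At most one of the \<open>k\<close> samples can violate it, and the second term
  corrects for the \<open>k\<close> ways in which this happens. When \<open>k = 0\<close> the truncated \<open>k - 1\<close> is
  multiplied by zero.
\<close>

lemma wsum_rec:
  assumes "finite A"
  shows "wsum p A j k = (\<Sum>i\<in>A. p i ^ j) * fesym p A k - real k * wsum p A (Suc j) (k - 1)"
proof (cases k)
  case 0
  then show ?thesis using assms by (simp add: wsum_def fesym_0)
next
  case (Suc l)
  have *: "fesym p (A - {i}) (Suc l) = fesym p A (Suc l) - real (Suc l) * p i * fesym p (A - {i}) l"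
    if "i \<in> A" for i
    using fesym_insert[of "A - {i}" i p l] assms that by (simp add: insert_absorb)
  show ?thesis
    unfolding Suc wsum_def
    by (simp add: * sum_distrib_left sum_distrib_right sum_subtractf algebra_simps cong: sum.cong)
qed

lemma fesym_scale: "fesym (\<lambda>i. c * p i) A m = c ^ m * fesym p A m"
proof -
  have "(\<Sum>B | B \<subseteq> A \<and> card B = m. \<Prod>i\<in>B. c * p i)
      = (\<Sum>B | B \<subseteq> A \<and> card B = m. c ^ m * (\<Prod>i\<in>B. p i))"
    by (intro sum.cong refl) (auto simp: prod.distrib)
  then show ?thesis by (simp add: fesym_def sum_distrib_left mult_ac)
qed

section \<open>Factorial moments of sums of independent indicators\<close>

lemma ffact_eq_choose: "ffact k m = fact m * real (k choose m)"
  unfolding ffact_def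
  by (simp add: binomial_gbinomial gbinomial_prod_rev atLeast0LessThan)

lemma ffact_nonneg: "ffact k m \<ge> 0"
  by (simp add: ffact_eq_choose)

lemma ffact_small: "k < m \<Longrightarrow> ffact k m = 0"
  by (simp add: ffact_eq_choose)

lemma ffact_2_3_4:
  "ffact k 2 = real k * (real k - 1)"
  "ffact k 3 = real k * (real k - 1) * (real k - 2)"
  "ffact k 4 = real k * (real k - 1) * (real k - 2) * (real k - 3)"
  by (simp_all add: ffact_def eval_nat_numeral)

text \<open>
  Both sides count the \<open>m\<close>-element subsets of the set where \<open>g\<close> is one: the product over \<open>B\<close> is
  the indicator that \<open>B\<close> lies in that set.
\<close>

lemma choose_sum_01:
  fixes g :: "'i \<Rightarrow> nat"
  assumes "finite A" "\<And>i. i \<in> A \<Longrightarrow> g i \<in> {0, 1}"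
  shows "(\<Sum>i\<in>A. g i) choose m = (\<Sum>B | B \<subseteq> A \<and> card B = m. \<Prod>i\<in>B. g i)"
proof -
  define T where "T = {i \<in> A. g i = 1}"
  have T: "finite T" "T \<subseteq> A" using assms by (auto simp: T_def)
  have "(\<Sum>i\<in>A. g i) = (\<Sum>i\<in>T. 1)"
    using assms by (intro sum.mono_neutral_cong_right) (fastforce simp: T_def)+
  then have "(\<Sum>i\<in>A. g i) choose m = card {B. B \<subseteq> T \<and> card B = m}"
    using T by (simp add: n_subsets)
  also have "\<dots> = (\<Sum>B | B \<subseteq> T \<and> card B = m. 1)" by simp
  also have "\<dots> = (\<Sum>B | B \<subseteq> A \<and> card B = m. \<Prod>i\<in>B. g i)"
  proof (rule sum.mono_neutral_cong_left)
    show "\<forall>B\<in>{B. B \<subseteq> A \<and> card B = m} - {B. B \<subseteq> T \<and> card B = m}. (\<Prod>i\<in>B. g i) = 0"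
    proof
      fix B assume B: "B \<in> {B. B \<subseteq> A \<and> card B = m} - {B. B \<subseteq> T \<and> card B = m}"
      then obtain i where "i \<in> B" "i \<notin> T" by auto
      then have "g i = 0" "finite B"
        using B assms by (fastforce simp: T_def dest: finite_subset)+
      then show "(\<Prod>i\<in>B. g i) = 0" using \<open>i \<in> B\<close> by (intro prod_zero) auto
    qed
    show "1 = (\<Prod>i\<in>B. g i)" if "B \<in> {B. B \<subseteq> T \<and> card B = m}" for B
      using that by (intro prod.neutral[symmetric]) (auto simp: T_def)
  qed (use assms T in auto)
  finally show ?thesis .
qed

text \<open>
  By \<open>choose_sum_01\<close> the falling factorial is a polynomial without squares in the indicators, so
  independence evaluates its expectation factor by factor.
\<close>

lemma (in prob_space) expectation_ffact_sum_indicators: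
  fixes X :: "'i \<Rightarrow> 'a \<Rightarrow> nat"
  assumes A: "finite A"
    and ind: "indep_vars (\<lambda>_. count_space UNIV) X A"
    and X01: "\<And>i x. i \<in> A \<Longrightarrow> x \<in> space M \<Longrightarrow> X i x \<in> {0, 1}"
  shows "expectation (\<lambda>x. ffact (\<Sum>i\<in>A. X i x) m)
     = fesym (\<lambda>i. prob {x \<in> space M. X i x = 1}) A m"
proof -
  have meas: "X i \<in> measurable M (count_space UNIV)" if "i \<in> A" for i
    using ind that unfolding indep_vars_def by auto
  have int: "integrable M (\<lambda>x. real (X i x))" if "i \<in> A" for i
    using X01 meas that
    by (intro integrable_const_bound[where B = 1] AE_I2) fastforce+
  have ex: "expectation (\<lambda>x. real (X i x)) = prob {x \<in> space M. X i x = 1}" if "i \<in> A" for i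
  proof -
    have "expectation (\<lambda>x. real (X i x)) = expectation (indicator {x \<in> space M. X i x = 1})"
      using X01[OF that] by (intro Bochner_Integration.integral_cong refl) (fastforce simp: indicator_def)
    also have "\<dots> = prob {x \<in> space M. X i x = 1}"
      by (simp add: Int_absorb2)
    finally show ?thesis .
  qed
  have indR: "indep_vars (\<lambda>_. borel) (\<lambda>i x. real (X i x)) A"
    using indep_vars_compose2[OF ind, of "\<lambda>_. real" "\<lambda>_. borel"] by simp
  have prodB: "integrable M (\<lambda>x. \<Prod>i\<in>B. real (X i x))"
      "expectation (\<lambda>x. \<Prod>i\<in>B. real (X i x)) = (\<Prod>i\<in>B. prob {x \<in> space M. X i x = 1})"
    if B: "B \<subseteq> A" for B
  proof -
    have *: "finite B" "indep_vars (\<lambda>_. borel) (\<lambda>i x. real (X i x)) B"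
      using B A indep_vars_subset[OF indR] by (auto dest: finite_subset)
    show "integrable M (\<lambda>x. \<Prod>i\<in>B. real (X i x))"
      using B int by (cases "B = {}") (auto intro!: indep_vars_integrable *)
    show "expectation (\<lambda>x. \<Prod>i\<in>B. real (X i x)) = (\<Prod>i\<in>B. prob {x \<in> space M. X i x = 1})"
    proof (cases "B = {}")
      case False
      then show ?thesis using B int ex
        by (subst indep_vars_lebesgue_integral) (auto intro!: * prod.cong)
    qed (simp add: prob_space)
  qed
  have "expectation (\<lambda>x. ffact (\<Sum>i\<in>A. X i x) m)
     = expectation (\<lambda>x. fact m * (\<Sum>B | B \<subseteq> A \<and> card B = m. \<Prod>i\<in>B. real (X i x)))"
    using choose_sum_01[OF A, of "\<lambda>i. X i _" m] X01
    by (intro Bochner_Integration.integral_cong refl) (simp add: ffact_eq_choose)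
  also have "\<dots> = fact m * (\<Sum>B | B \<subseteq> A \<and> card B = m. \<Prod>i\<in>B. prob {x \<in> space M. X i x = 1})"
    using prodB by (simp add: Bochner_Integration.integral_sum)
  finally show ?thesis by (simp add: fesym_def)
qed

section \<open>Alternating bounds for normalised weights\<close>

locale prob_weights =
  fixes p :: "'i \<Rightarrow> real" and A :: "'i set"
  assumes fin: "finite A"
    and nonneg: "i \<in> A \<Longrightarrow> p i \<ge> 0"
    and total: "(\<Sum>i\<in>A. p i) = 1"
begin

abbreviation "f \<equiv> fesym p A"
abbreviation "w \<equiv> wsum p A"
abbreviation "l j \<equiv> (\<Sum>i\<in>A. p i ^ j)"

lemma l_nonneg: "l j \<ge> 0"
  by (intro sum_nonneg zero_le_power nonneg)

lemma w_nonneg: "w j k \<ge> 0"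
  unfolding wsum_def using nonneg
  by (intro sum_nonneg mult_nonneg_nonneg fesym_nonneg) auto

lemma w_le: "w j k \<le> l j * f k"
  using wsum_rec[OF fin, of p j k] w_nonneg[of "Suc j" "k - 1"] by simp

text \<open>
  The increment which all three bounds below sum over. Normalisation enters here, by making the
  leading coefficient equal to one.
\<close>

lemma f_Suc: "f (Suc k) = f k - real k * w 2 (k - 1)"
  using fesym_Suc_eq_wsum[OF fin, of p k] wsum_rec[OF fin, of p 1 k] total
  by (simp add: numeral_2_eq_2)

lemma f_le_1: "f m \<le> 1"
proof (induction m)
  case (Suc m)
  then show ?case using f_Suc[of m] w_nonneg[of 2 "m - 1"]
    by (smt (verit) mult_nonneg_nonneg of_nat_0_le_iff)
qed (simp add: fesym_0 fin)

lemma w_le_l: "w j k \<le> l j"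
  using w_le[of j k] f_le_1[of k] l_nonneg[of j] by (smt (verit) mult_left_le)

text \<open>
  Under the distribution \<open>p\<close>, the random variable \<open>i \<mapsto> p i\<close> has mean \<open>l 2\<close> and second
  moment \<open>l 3\<close>; its variance is nonnegative.
\<close>

lemma l_2_sq_le_l_3: "(l 2)\<^sup>2 \<le> l 3"
proof -
  have "0 \<le> (\<Sum>i\<in>A. p i * (p i - l 2)\<^sup>2)"
    using nonneg by (intro sum_nonneg) auto
  also have "\<dots> = (\<Sum>i\<in>A. p i ^ 3 - 2 * l 2 * p i ^ 2 + (l 2)\<^sup>2 * p i)"
    by (intro sum.cong refl) (simp add: power2_eq_square power3_eq_cube algebra_simps)
  also have "\<dots> = l 3 - 2 * l 2 * l 2 + (l 2)\<^sup>2 * (\<Sum>i\<in>A. p i)"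
    by (simp add: sum.distrib sum_subtractf flip: sum_distrib_left)
  finally show ?thesis using total by (simp add: power2_eq_square)
qed

text \<open>
  For the same random variable, the covariance with its square is nonnegative, since
  \<open>(u - v) (u\<^sup>2 - v\<^sup>2) = (u - v)\<^sup>2 (u + v)\<close>.
\<close>

lemma l_2_mult_l_3_le_l_4: "l 2 * l 3 \<le> l 4"
proof -
  have "0 \<le> (\<Sum>i\<in>A. p i * ((p i - l 2)\<^sup>2 * (p i + l 2)))"
    using nonneg l_nonneg[of 2] by (intro sum_nonneg mult_nonneg_nonneg add_nonneg_nonneg) auto
  also have "\<dots> = (\<Sum>i\<in>A. p i ^ 4 - l 2 * p i ^ 3 - (l 2)\<^sup>2 * p i ^ 2 + l 2 ^ 3 * p i)"
    by (intro sum.cong refl) (simp add: power2_eq_square power3_eq_cube power4_eq_xxxx algebra_simps)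
  also have "\<dots> = l 4 - l 2 * l 3 - (l 2)\<^sup>2 * l 2 + l 2 ^ 3 * (\<Sum>i\<in>A. p i)"
    by (simp add: sum.distrib sum_subtractf flip: sum_distrib_left)
  finally show ?thesis using total by (simp add: power2_eq_square power3_eq_cube)
qed

lemma l_2_cube_le_l_4: "l 2 ^ 3 \<le> l 4"
proof -
  have "l 2 ^ 3 = l 2 * (l 2)\<^sup>2" by (simp add: power2_eq_square power3_eq_cube)
  also have "\<dots> \<le> l 2 * l 3" by (intro mult_left_mono l_2_sq_le_l_3 l_nonneg)
  finally show ?thesis using l_2_mult_l_3_le_l_4 by simp
qed

text \<open>
  The union bound over the \<open>m (m - 1) / 2\<close> pairs of samples that may coincide, obtained here from
  \<open>w 2 k \<le> l 2\<close>.
\<close>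

lemma f_ge_order_1: "f m \<ge> 1 - real m * (real m - 1) / 2 * l 2"
proof (induction m)
  case (Suc m)
  have "real m * w 2 (m - 1) \<le> real m * l 2"
    by (intro mult_left_mono w_le_l) simp
  then show ?case using Suc f_Suc[of m] by (simp add: field_simps)
qed (simp add: fesym_0 fin)

text \<open>
  One expansion of \<open>w 2\<close>: its main term \<open>l 2 * f k\<close> is bounded below by \<open>f_ge_order_1\<close>, its
  correction by \<open>w 3 \<le> l 3\<close>. All estimates lose nothing in the coefficients of \<open>l 2\<close>,
  \<open>l 3\<close> and \<open>(l 2)\<^sup>2\<close>, which are those of the expansion of \<open>m! e\<^sub>m\<close> in power sums.
\<close>

lemma f_le_order_2:
  "f m \<le> 1 - real m * (real m - 1) / 2 * l 2 + real m * (real m - 1) * (real m - 2) / 3 * l 3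
     + real m * (real m - 1) * (real m - 2) * (real m - 3) / 8 * (l 2)\<^sup>2"
proof (induction m)
  case (Suc m)
  show ?case
  proof (cases m)
    case 0
    then show ?thesis using f_Suc[of 0] by (simp add: fesym_0 fin)
  next
    case m: (Suc k)
    have "w 2 k = l 2 * f k - real k * w 3 (k - 1)"
      using wsum_rec[OF fin, of p 2 k] by simp
    moreover have "l 2 * f k \<ge> l 2 * (1 - real k * (real k - 1) / 2 * l 2)"
      by (intro mult_left_mono f_ge_order_1 l_nonneg)
    moreover have "real k * w 3 (k - 1) \<le> real k * l 3"
      by (intro mult_left_mono w_le_l) simp
    ultimately have "w 2 k \<ge> l 2 * (1 - real k * (real k - 1) / 2 * l 2) - real k * l 3"
      by linarith
    then have "real m * w 2 k \<ge> real m * (l 2 * (1 - real k * (real k - 1) / 2 * l 2) - real k * l 3)"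
      by (intro mult_left_mono) simp_all
    then show ?thesis using Suc f_Suc[of m]
      by (simp add: m field_simps power2_eq_square)
  qed
qed (simp add: fesym_0 fin)

text \<open>
  Two expansions of \<open>w 2\<close>: the main term is bounded above by \<open>f_le_order_2\<close>, and \<open>w 3\<close> is
  bounded below by \<open>f_ge_order_1\<close> and \<open>w 4 \<le> l 4\<close>. The products \<open>l 2 * l 3\<close> and \<open>l 2 ^ 3\<close> that appear
  are then replaced by \<open>l 4\<close>, so that a single error coefficient remains.
\<close>

lemma f_ge_order_3:
  "f m \<ge> 1 - real m * (real m - 1) / 2 * l 2 + real m * (real m - 1) * (real m - 2) / 3 * l 3
     + real m * (real m - 1) * (real m - 2) * (real m - 3) / 8 * (l 2)\<^sup>2
     - real m * (real m - 1) * (real m - 2) * (real m - 3) * (real m * (real m - 1)) / 48 * l 4"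
proof (induction m)
  case (Suc m)
  show ?case
  proof (cases m)
    case 0
    then show ?thesis using f_Suc[of 0] by (simp add: fesym_0 fin)
  next
    case m: (Suc k)
    define x where "x = real k"
    \<comment> \<open>Falling factorials of a real number can be negative, those of a natural number cannot.\<close>
    have ff: "x * (x - 1) * (x - 2) \<ge> 0" "x * (x - 1) * (x - 2) * (x - 3) \<ge> 0"
      using ffact_nonneg[of k 3] ffact_nonneg[of k 4] by (simp_all add: ffact_2_3_4 x_def)
    have w2: "w 2 k = l 2 * f k - x * w 3 (k - 1)"
      using wsum_rec[OF fin, of p 2 k] by (simp add: x_def)
    have "l 2 * f k \<le> l 2 * (1 - x * (x - 1) / 2 * l 2 + x * (x - 1) * (x - 2) / 3 * l 3
        + x * (x - 1) * (x - 2) * (x - 3) / 8 * (l 2)\<^sup>2)"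
      unfolding x_def by (intro mult_left_mono f_le_order_2 l_nonneg)
    also have "\<dots> = l 2 - x * (x - 1) / 2 * (l 2)\<^sup>2 + x * (x - 1) * (x - 2) / 3 * (l 2 * l 3)
        + x * (x - 1) * (x - 2) * (x - 3) / 8 * l 2 ^ 3"
      by (simp add: field_simps power2_eq_square power3_eq_cube)
    finally have up: "l 2 * f k \<le> \<dots>" .
    have low: "x * w 3 (k - 1) \<ge> x * l 3 - x * (x - 1) * (x - 2) / 2 * (l 2 * l 3) - x * (x - 1) * l 4"
    proof (cases k)
      case k: (Suc r)
      have "l 3 * f r \<ge> l 3 * (1 - real r * (real r - 1) / 2 * l 2)"
        by (intro mult_left_mono f_ge_order_1 l_nonneg)
      moreover have "real r * w 4 (r - 1) \<le> real r * l 4"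
        by (intro mult_left_mono w_le_l) simp
      moreover have "w 3 r = l 3 * f r - real r * w 4 (r - 1)"
        using wsum_rec[OF fin, of p 3 r] by simp
      ultimately have "w 3 r \<ge> l 3 * (1 - real r * (real r - 1) / 2 * l 2) - real r * l 4"
        by linarith
      then have "x * w 3 r \<ge> x * (l 3 * (1 - real r * (real r - 1) / 2 * l 2) - real r * l 4)"
        by (intro mult_left_mono) (simp_all add: x_def)
      then show ?thesis by (simp add: k x_def field_simps)
    qed (simp add: x_def)
    \<comment> \<open>The fraction is \<open>1/3 + 1/2\<close>: \<open>l 2 * l 3\<close> occurs both in \<open>up\<close> and in \<open>low\<close>.\<close>
    have "5 / 6 * (x * (x - 1) * (x - 2)) * (l 2 * l 3) \<le> 5 / 6 * (x * (x - 1) * (x - 2)) * l 4"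
      using ff by (intro mult_left_mono l_2_mult_l_3_le_l_4) simp
    moreover have "x * (x - 1) * (x - 2) * (x - 3) / 8 * l 2 ^ 3 \<le> x * (x - 1) * (x - 2) * (x - 3) / 8 * l 4"
      using ff by (intro mult_left_mono l_2_cube_le_l_4) simp
    moreover have "x * (x - 1) * (x - 2) / 3 * (l 2 * l 3) + x * (x - 1) * (x - 2) / 2 * (l 2 * l 3)
        = 5 / 6 * (x * (x - 1) * (x - 2)) * (l 2 * l 3)"
      by (simp add: field_simps)
    ultimately have "w 2 k \<le> l 2 - x * (x - 1) / 2 * (l 2)\<^sup>2 - x * l 3
       + (5 / 6 * (x * (x - 1) * (x - 2)) + x * (x - 1) * (x - 2) * (x - 3) / 8 + x * (x - 1)) * l 4"
      using w2 up low unfolding distrib_right by argo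
    then have "real m * w 2 k \<le> real m * (l 2 - x * (x - 1) / 2 * (l 2)\<^sup>2 - x * l 3
       + (5 / 6 * (x * (x - 1) * (x - 2)) + x * (x - 1) * (x - 2) * (x - 3) / 8 + x * (x - 1)) * l 4)"
      by (intro mult_left_mono) simp_all
    then show ?thesis using Suc f_Suc[of m]
      by (simp add: m x_def field_simps power2_eq_square)
  qed
qed (simp add: fesym_0 fin)

end

theorem lemma4p3:
  fixes M :: "'a measure" and I :: "nat \<Rightarrow> 'a \<Rightarrow> nat"
    and n :: nat and p :: "nat \<Rightarrow> real"
    and S :: "'a \<Rightarrow> nat" and \<Lambda> :: "nat \<Rightarrow> real" and \<mu> :: "nat \<Rightarrow> real"
  assumes "prob_space M"
    and "n \<ge> 1"
    and "prob_space.indep_vars M (\<lambda>_. count_space UNIV) I {1..n}"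
    and "\<And>i x. i \<in> {1..n} \<Longrightarrow> x \<in> space M \<Longrightarrow> I i x \<in> {0, 1}"
    and "\<And>i. i \<in> {1..n} \<Longrightarrow> p i = measure M {x \<in> space M. I i x = 1}"
    and "\<And>x. S x = (\<Sum>i=1..n. I i x)"
    and "\<And>j. \<Lambda> j = (\<Sum>i=1..n. p i ^ j)"
    and "\<Lambda> 1 > 0"
    and "\<And>m. \<mu> m = (LINT x|M. ffact (S x) m)"
  shows "\<forall>m\<ge>1. \<mu> m \<ge> \<Lambda> 1 ^ m
      - ffact m 2 / 2 * \<Lambda> 2 * \<Lambda> 1 ^ (m - 2)
      + ffact m 3 / 3 * \<Lambda> 3 * \<Lambda> 1 ^ (m - 3)
      + ffact m 4 / 8 * (\<Lambda> 2)\<^sup>2 * \<Lambda> 1 ^ (m - 4)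
      - ffact m 4 * ffact m 2 / 48 * \<Lambda> 4 * \<Lambda> 1 ^ (m - 4)"
proof (intro allI impI)
  fix m :: nat
  define L where "L = \<Lambda> 1"
  have L: "L > 0" using assms(8) by (simp add: L_def)
  define q where "q = (\<lambda>i. inverse L * p i)"
  have p: "p = (\<lambda>i. L * q i)" using L by (intro ext) (simp add: q_def)
  interpret prob_space M by fact
  have "\<mu> m = fesym (\<lambda>i. prob {x \<in> space M. I i x = 1}) {1..n} m"
    using expectation_ffact_sum_indicators[OF _ assms(3,4), of m] assms(6,9) by simp
  also have "\<dots> = fesym p {1..n} m"
    unfolding fesym_def using assms(5)
    by (intro arg_cong2[where f = "(*)"] refl sum.cong prod.cong) auto
  also have "\<dots> = L ^ m * fesym q {1..n} m"
    by (subst p) (rule fesym_scale)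
  finally have \<mu>: "\<mu> m = L ^ m * fesym q {1..n} m" .
  have \<Lambda>: "\<Lambda> j = L ^ j * (\<Sum>i=1..n. q i ^ j)" for j
    unfolding assms(7) by (subst p) (simp add: power_mult_distrib sum_distrib_left)
  interpret prob_weights q "{1..n}"
  proof
    show "q i \<ge> 0" if "i \<in> {1..n}" for i
      using L assms(5)[OF that] by (simp add: q_def)
    show "(\<Sum>i=1..n. q i) = 1" using \<Lambda>[of 1] L by (simp add: L_def)
  qed simp
  \<comment> \<open>The exponent \<open>m - j\<close> truncates exactly when the falling factorial vanishes.\<close>
  have pow: "ffact m j * L ^ m = ffact m j * (L ^ j * L ^ (m - j))" for j
    by (cases "m < j") (simp_all add: ffact_small flip: power_add)
  have "\<mu> m \<ge> L ^ m * (1 - ffact m 2 / 2 * l 2 + ffact m 3 / 3 * l 3 + ffact m 4 / 8 * (l 2)\<^sup>2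
     - ffact m 4 * ffact m 2 / 48 * l 4)"
    unfolding \<mu> ffact_2_3_4 using L by (intro mult_left_mono f_ge_order_3) simp
  also have "L ^ m * (1 - ffact m 2 / 2 * l 2 + ffact m 3 / 3 * l 3 + ffact m 4 / 8 * (l 2)\<^sup>2
     - ffact m 4 * ffact m 2 / 48 * l 4)
     = L ^ m - (ffact m 2 * L ^ m) / 2 * l 2 + (ffact m 3 * L ^ m) / 3 * l 3
       + (ffact m 4 * L ^ m) / 8 * (l 2)\<^sup>2 - (ffact m 4 * L ^ m) * ffact m 2 / 48 * l 4"
    by (simp add: algebra_simps)
  also have "\<dots> = L ^ m - ffact m 2 / 2 * \<Lambda> 2 * L ^ (m - 2) + ffact m 3 / 3 * \<Lambda> 3 * L ^ (m - 3)
      + ffact m 4 / 8 * (\<Lambda> 2)\<^sup>2 * L ^ (m - 4) - ffact m 4 * ffact m 2 / 48 * \<Lambda> 4 * L ^ (m - 4)"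
    unfolding pow \<Lambda> by (simp add: power2_eq_square power3_eq_cube power4_eq_xxxx algebra_simps)
  finally show "\<mu> m \<ge> \<Lambda> 1 ^ m
      - ffact m 2 / 2 * \<Lambda> 2 * \<Lambda> 1 ^ (m - 2)
      + ffact m 3 / 3 * \<Lambda> 3 * \<Lambda> 1 ^ (m - 3)
      + ffact m 4 / 8 * (\<Lambda> 2)\<^sup>2 * \<Lambda> 1 ^ (m - 4)
      - ffact m 4 * ffact m 2 / 48 * \<Lambda> 4 * \<Lambda> 1 ^ (m - 4)"
    unfolding L_def .
qed

end
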